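(* Let $s \geq 1$ and $t > 1$ be integers, and let $\beta_{s,t}$ denote the type-$\beta$ comb with $s$ teeth of length $t$. Then the number of linear extensions of $\beta_{s,t}$ that avoid the pattern $312$ equals $$\frac{1}{ts+1}\binom{s(t+1)}{s},$$ which is the number of $(t+1)$-ary trees on $s$ nodes.
   Context: A linear extension of a finite poset $P$ on a set of integers is a listing $v=[v_1,\dots,v_n]$ of all elements of $P$, each exactly once, such that whenever $a \leq_P b$, $a$ appears before $b$. For a pattern $w \in S_3$, a sequence $v$ of distinct integers contains $w$ if there are indices $i<j<k$ such that $(v_i,v_j,v_k)$ is in the same relative order as $(w_1,w_2,w_3)$; otherwise $v$ avoids $w$. The type-$\beta$ comb $\beta_{s,t}$ is the poset on $\{1,\dots,st\}$ whose order is generated by the relations $ct+1 \leq (c+1)t+1$ for $0 \leq c \leq s-2$ (the spine $1, t+1, 2t+1,\dots,(s-1)t+1$) and $ct+j \leq ct+j+1$ for $0 \leq c \leq s-1$, $1 \leq j \leq t-1$ (the teeth $\{ct+1,\dots,ct+t\}$). A $(t+1)$-ary tree is a rooted tree, with unlabeled nodes and only its shape considered, in which every node has at most $t+1$ children. *)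

theory Defs
  imports Complex_Main
begin

definition linear_extension :: "'a set \<Rightarrow> 'a rel \<Rightarrow> 'a list \<Rightarrow> bool" where
  "linear_extension A r v \<longleftrightarrow>
     distinct v \<and> set v = A \<and>
     (\<forall>i<length v. \<forall>j<length v. (v ! i, v ! j) \<in> r \<and> v ! i \<noteq> v ! j \<longrightarrow> i < j)"

definition same_relative_order :: "'a::linorder list \<Rightarrow> 'b::linorder list \<Rightarrow> bool" where
  "same_relative_order u w \<longleftrightarrow>
     length u = length w \<and>
     (\<forall>a<length w. \<forall>b<length w. u ! a < u ! b \<longleftrightarrow> w ! a < w ! b)"

text \<open>Patterns are permutations of length 3 in one-line notation.\<close>

definition contains3 :: "'a::linorder list \<Rightarrow> nat list \<Rightarrow> bool" where
  "contains3 v w \<longleftrightarrow>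
     (\<exists>i j k. i < j \<and> j < k \<and> k < length v \<and> same_relative_order [v ! i, v ! j, v ! k] w)"

definition avoids3 :: "'a::linorder list \<Rightarrow> nat list \<Rightarrow> bool" where
  "avoids3 v w \<longleftrightarrow> \<not> contains3 v w"

definition comb_carrier :: "nat \<Rightarrow> nat \<Rightarrow> nat set" where
  "comb_carrier s t = {1..s * t}"

text \<open>The bound \<open>c \<le> s - 2\<close> on the spine is written \<open>c + 2 \<le> s\<close>, and \<open>c \<le> s - 1\<close>, \<open>j \<le> t - 1\<close>
  on the teeth are written \<open>c < s\<close>, \<open>j < t\<close>, to avoid truncated subtraction.\<close>

definition comb_generators :: "nat \<Rightarrow> nat \<Rightarrow> nat rel" where
  "comb_generators s t =
     {(c * t + 1, (c + 1) * t + 1) | c. c + 2 \<le> s} \<union>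
     {(c * t + j, c * t + j + 1) | c j. c < s \<and> 1 \<le> j \<and> j < t}"

text \<open>The intersection only removes the reflexive pairs that \<open>\<^sup>*\<close> adds outside the carrier.\<close>

definition comb_order :: "nat \<Rightarrow> nat \<Rightarrow> nat rel" where
  "comb_order s t = (comb_generators s t)\<^sup>* \<inter> comb_carrier s t \<times> comb_carrier s t"

lemma comb_order_partial_order: "partial_order_on (comb_carrier s t) (comb_order s t)"
proof -
  have le: "a \<le> b" if "(a, b) \<in> (comb_generators s t)\<^sup>*" for a b
    using that
  proof (induction rule: rtrancl_induct)
    case (step b c)
    from step.hyps(2) have "b \<le> c"
      unfolding comb_generators_def by fastforce
    with step.IH show ?case by (rule le_trans)
  qed simp
  have "refl_on (comb_carrier s t) (comb_order s t)"
    unfolding refl_on_def comb_order_def by blast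
  moreover have "comb_order s t \<subseteq> comb_carrier s t \<times> comb_carrier s t"
    unfolding comb_order_def by blast
  moreover have "trans (comb_order s t)"
    unfolding comb_order_def by (intro trans_Int trans_rtrancl) (simp add: trans_def)
  moreover have "antisym (comb_order s t)"
  proof (rule antisymI)
    fix a b assume "(a, b) \<in> comb_order s t" "(b, a) \<in> comb_order s t"
    then have "a \<le> b" "b \<le> a"
      unfolding comb_order_def using le by blast+
    then show "a = b" by (rule antisym)
  qed
  ultimately show ?thesis
    unfolding partial_order_on_def preorder_on_def by blast
qed

text \<open>In a \<open>k\<close>-ary tree every node has \<open>k\<close> ordered child positions, each of which holds either
  a child or nothing (\<open>Empty\<close>); trees that differ in which positions are occupied are distinct,
  as for binary trees with left and right children.\<close>

datatype tree = Empty | Node "tree list"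

primrec num_nodes :: "tree \<Rightarrow> nat" where
  "num_nodes Empty = 0"
| "num_nodes (Node ts) = 1 + sum_list (map num_nodes ts)"

primrec kary_tree :: "nat \<Rightarrow> tree \<Rightarrow> bool" where
  "kary_tree k Empty \<longleftrightarrow> True"
| "kary_tree k (Node ts) \<longleftrightarrow> length ts = k \<and> list_all (kary_tree k) ts"

end

theory Submission
  imports Defs
begin

text \<open>Removing the largest entry from a 312-avoiding list leaves a 312-avoiding list, and it can be
  put back exactly at those places after which the list is decreasing. Let the tail of a list be the
  part that starts at its largest entry. The tail is the longest decreasing suffix, so inserting
  \<open>n + 1\<close> into a list with a tail of length \<open>l\<close> creates a tail of any length
  from \<open>1\<close> to \<open>l + 1\<close>, except that \<open>l + 1\<close> is forbidden when \<open>n\<close> must precede \<open>n + 1\<close> on a tooth.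
  The spine relations hold automatically: if \<open>(c + 1)t + 1\<close> came before \<open>ct + 1\<close>, then
  these two and \<open>ct + 2\<close> would form a 312. Counting the lists by length and tail length
  gives the recurrence that also counts ordered forests of \<open>(t + 1)\<close>-ary trees: the first tree of a
  forest is either empty and can be dropped, or it can be replaced by its \<open>t + 1\<close> subtrees.\<close>

section \<open>Forests of \<open>k\<close>-ary trees\<close>

text \<open>The Raney numbers: coefficient of \<open>x^s\<close> in \<open>B^m\<close>, where
  \<open>B = 1 + x * B^k\<close> is the generating function of \<open>k\<close>-ary trees. The
  recursion compares coefficients in \<open>B^(m + 1) = B^m + x * B^(m + k)\<close>.\<close>

fun forest_number :: "nat \<Rightarrow> nat \<Rightarrow> nat \<Rightarrow> nat" where
  "forest_number k m 0 = 1"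
| "forest_number k 0 (Suc s) = 0"
| "forest_number k (Suc m) (Suc s) = forest_number k m (Suc s) + forest_number k (m + k) s"

lemma forest_number_closed_form:
  assumes "k > 0"
  shows "(k * s + m) * forest_number k m s = m * ((k * s + m) choose s)"
  using assms
proof (induction k m s rule: forest_number.induct)
  case (3 k m s)
  define N where "N = k * Suc s + m"
  \<comment> \<open>Both summands of the recursion have the same value \<open>N\<close> of
    \<open>k * s + m\<close>, so their closed forms combine by Pascal's rule.\<close>
  have N: "k * s + (m + k) = N" "k * Suc s + Suc m = Suc N" by (simp_all add: N_def)
  have pos: "N > 0" using 3(3) by (simp add: N_def)
  have IH: "N * forest_number k m (Suc s) = m * (N choose Suc s)"
    "N * forest_number k (m + k) s = (m + k) * (N choose s)"
    using 3 unfolding N by (simp_all add: N_def)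
  \<comment> \<open>Pascal's rule leaves \<open>k * (N choose s)\<close> over; absorption turns it
    into a multiple of \<open>Suc N choose Suc s\<close>.\<close>
  have absorb: "Suc N * (N choose s) = Suc s * (Suc N choose Suc s)"
    using Suc_times_binomial_eq[of N s] by (simp only: mult.commute)
  have "N * (Suc N * forest_number k (Suc m) (Suc s)) =
      Suc N * (N * forest_number k m (Suc s) + N * forest_number k (m + k) s)"
    by (simp add: algebra_simps)
  also have "\<dots> = Suc N * m * (Suc N choose Suc s) + k * (Suc N * (N choose s))"
    unfolding IH by (simp add: algebra_simps)
  also have "\<dots> = (Suc N * m + k * Suc s) * (Suc N choose Suc s)"
    unfolding absorb by (simp only: algebra_simps)
  also have "Suc N * m + k * Suc s = N * Suc m"
    by (simp add: N_def)
  finally have "N * (Suc N * forest_number k (Suc m) (Suc s)) =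
      N * (Suc m * (Suc N choose Suc s))"
    by (simp only: mult.assoc)
  then show ?case unfolding N using pos by (simp only: mult_cancel1) simp
qed auto

definition forests :: "nat \<Rightarrow> nat \<Rightarrow> nat \<Rightarrow> tree list set" where
  "forests k m s = {ts. length ts = m \<and> list_all (kary_tree k) ts \<and> sum_list (map num_nodes ts) = s}"

lemma num_nodes_eq_0_iff [simp]: "num_nodes T = 0 \<longleftrightarrow> T = Empty"
  by (cases T) auto

lemma forests_no_nodes: "forests k m 0 = {replicate m Empty}"
  unfolding forests_def
  by (auto simp: list_all_iff intro!: replicate_eqI)

lemma forests_no_trees: "forests k 0 (Suc s) = {}"
  unfolding forests_def by auto

lemma forests_rec:
  "forests k (Suc m) (Suc s) =
     (#) Empty ` forests k m (Suc s) \<union> (\<lambda>ts. Node (take k ts) # drop k ts) ` forests k (m + k) s"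
  (is "?L = ?A \<union> ?B")
proof
  show "?L \<subseteq> ?A \<union> ?B"
  proof
    fix us assume "us \<in> ?L"
    then obtain T ts where us: "us = T # ts" and T: "kary_tree k T" and
      ts: "length ts = m" "list_all (kary_tree k) ts"
      "num_nodes T + sum_list (map num_nodes ts) = Suc s"
      unfolding forests_def by (cases us) auto
    show "us \<in> ?A \<union> ?B"
    proof (cases T)
      case Empty
      then show ?thesis using us ts by (auto simp: forests_def)
    next
      case (Node cs)
      then have "us = (\<lambda>ts. Node (take k ts) # drop k ts) (cs @ ts)" "cs @ ts \<in> forests k (m + k) s"
        using us T ts by (auto simp: forests_def)
      then show ?thesis by blast
    qed
  qed
next
  have "sum_list (map num_nodes (take k ts)) + sum_list (map num_nodes (drop k ts))
      = sum_list (map num_nodes ts)" for ts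
    by (metis append_take_drop_id map_append sum_list_append)
  moreover have "list_all P (take k ts)" "list_all P (drop k ts)" if "list_all P ts" for P and ts :: "tree list"
    using that by (auto simp: list_all_iff dest: in_set_takeD in_set_dropD)
  ultimately show "?A \<union> ?B \<subseteq> ?L"
    by (auto simp: forests_def)
qed

lemma card_forests: "finite (forests k m s) \<and> card (forests k m s) = forest_number k m s"
proof (induction k m s rule: forest_number.induct)
  case (3 k m s)
  have "inj_on (\<lambda>ts. Node (take k ts) # drop k ts) (forests k (m + k) s)"
    by (rule inj_onI) (metis append_take_drop_id list.inject tree.inject)
  then show ?case
    using 3 unfolding forests_rec
    by (subst card_Un_disjoint) (auto simp: card_image)
qed (simp_all add: forests_no_nodes forests_no_trees)

lemma card_kary_trees: "card {T. kary_tree k T \<and> num_nodes T = s} = forest_number k 1 s"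
proof -
  have "forests k 1 s = (\<lambda>T. [T]) ` {T. kary_tree k T \<and> num_nodes T = s}"
    by (auto simp: forests_def length_Suc_conv)
  then have "card (forests k 1 s) = card {T. kary_tree k T \<and> num_nodes T = s}"
    by (simp add: card_image inj_on_def)
  then show ?thesis by (simp add: card_forests)
qed

lemma forest_number_single:
  "real (forest_number (t + 1) 1 s) = 1 / (real t * real s + 1) * real ((s * (t + 1)) choose s)"
proof -
  define N where "N = (t + 1) * s"
  define A where "A = forest_number (t + 1) 1 s"
  have "Suc N * A = Suc N choose s"
    using forest_number_closed_form[of "t + 1" s 1] by (simp add: N_def A_def)
  \<comment> \<open>Here \<open>Suc N - s = t * s + 1\<close>, so absorption lowers the upper index
    and produces the denominator of the stated formula.\<close>
  moreover have "(t * s + 1) * (Suc N choose s) = Suc N * (N choose s)"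
    using binomial_absorb_comp[of "Suc N" s] by (simp add: N_def Suc_diff_le)
  ultimately have "Suc N * ((t * s + 1) * A) = Suc N * (N choose s)"
    by (metis mult.left_commute)
  then have "(t * s + 1) * A = N choose s" by (simp only: mult_cancel1) simp
  then have "(real t * real s + 1) * real A = real (N choose s)"
    by (metis of_nat_1 of_nat_add of_nat_mult)
  moreover have "real t * real s + 1 > 0" by (simp add: add_nonneg_pos)
  ultimately show ?thesis
    unfolding A_def N_def by (simp add: field_simps)
qed

section \<open>312-avoiding lists\<close>

text \<open>The head is tested as the 3 of a pattern. This recursive form suits inductions on the
  part of a list before an inserted entry.\<close>

primrec avoids_312 :: "nat list \<Rightarrow> bool" where
  "avoids_312 [] \<longleftrightarrow> True"
| "avoids_312 (x # xs) \<longleftrightarrow> sorted_wrt (\<lambda>y z. \<not> (y < z \<and> z < x)) xs \<and> avoids_312 xs"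

lemma avoids_312_iff_nth:
  "avoids_312 v \<longleftrightarrow>
     (\<forall>i j k. i < j \<longrightarrow> j < k \<longrightarrow> k < length v \<longrightarrow> \<not> (v ! j < v ! k \<and> v ! k < v ! i))"
proof (induction v)
  case (Cons x xs)
  have "(\<forall>i j k. i < j \<longrightarrow> j < k \<longrightarrow> k < length (x # xs) \<longrightarrow>
          \<not> ((x # xs) ! j < (x # xs) ! k \<and> (x # xs) ! k < (x # xs) ! i)) \<longleftrightarrow>
        (\<forall>j k. j < k \<longrightarrow> k < length xs \<longrightarrow> \<not> (xs ! j < xs ! k \<and> xs ! k < x)) \<and>
        (\<forall>i j k. i < j \<longrightarrow> j < k \<longrightarrow> k < length xs \<longrightarrow> \<not> (xs ! j < xs ! k \<and> xs ! k < xs ! i))"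
    (is "?L \<longleftrightarrow> ?R1 \<and> ?R2")
  proof (intro iffI conjI allI impI)
    fix j k assume L: ?L and "j < k" "k < length xs"
    then show "\<not> (xs ! j < xs ! k \<and> xs ! k < x)"
      using L[rule_format, of 0 "Suc j" "Suc k"] by simp
  next
    fix i j k assume L: ?L and "i < j" "j < k" "k < length xs"
    then show "\<not> (xs ! j < xs ! k \<and> xs ! k < xs ! i)"
      using L[rule_format, of "Suc i" "Suc j" "Suc k"] by simp
  next
    fix i j k assume R: "?R1 \<and> ?R2" and ijk: "i < j" "j < k" "k < length (x # xs)"
    obtain j' k' where jk: "j = Suc j'" "k = Suc k'"
      using ijk by (metis less_imp_Suc_add)
    show "\<not> ((x # xs) ! j < (x # xs) ! k \<and> (x # xs) ! k < (x # xs) ! i)"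
    proof (cases i)
      case 0
      then show ?thesis using R[THEN conjunct1, rule_format, of j' k'] ijk jk by simp
    next
      case (Suc i')
      then show ?thesis using R[THEN conjunct2, rule_format, of i' j' k'] ijk jk by simp
    qed
  qed
  then show ?case
    unfolding avoids_312.simps Cons.IH sorted_wrt_iff_nth_less by blast
qed simp

lemma avoids3_312_iff: "avoids3 v [3, 1, 2] \<longleftrightarrow> avoids_312 v"
proof -
  have "same_relative_order [x, y, z] [3 :: nat, 1, 2] \<longleftrightarrow> y < z \<and> z < x" for x y z :: nat
    unfolding same_relative_order_def by (auto simp: All_less_Suc2 numeral_3_eq_3)
  then show ?thesis
    unfolding avoids3_def contains3_def avoids_312_iff_nth by blast
qed

text \<open>An entry above all others can only be the 3 of a 312, and it is one exactly when an
  ascent occurs after it.\<close>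

lemma avoids_312_insert_max:
  assumes "\<forall>x \<in> set (u @ d). x < m"
  shows "avoids_312 (u @ m # d) \<longleftrightarrow> avoids_312 (u @ d) \<and> sorted_wrt (\<ge>) d"
  using assms
proof (induction u)
  case Nil
  then have "sorted_wrt (\<lambda>y z. \<not> (y < z \<and> z < m)) d \<longleftrightarrow> sorted_wrt (\<ge>) d"
    by (induction d) auto
  then show ?case by auto
next
  case (Cons x u)
  then show ?case by (auto simp: sorted_wrt_append)
qed

section \<open>Counting by tail length\<close>

text \<open>Teeth end at the multiples of \<open>t\<close>, so \<open>b mod t \<noteq> 0\<close>
  says that \<open>b\<close> and \<open>b + 1\<close> share a tooth. The number of teeth does not
  enter, hence \<open>comb_lists\<close> makes sense for every \<open>n\<close>, also with an
  unfinished last tooth.\<close>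

definition teeth_sorted :: "nat \<Rightarrow> nat list \<Rightarrow> bool" where
  "teeth_sorted t = sorted_wrt (\<lambda>a b. \<not> (a = Suc b \<and> b mod t \<noteq> 0))"

definition comb_lists :: "nat \<Rightarrow> nat \<Rightarrow> nat list set" where
  "comb_lists t n = {v. distinct v \<and> set v = {1..n} \<and> avoids_312 v \<and> teeth_sorted t v}"

definition tail_length :: "nat \<Rightarrow> nat list \<Rightarrow> nat" where
  "tail_length n v = length (dropWhile (\<lambda>x. x \<noteq> n) v)"

lemma tail_length_append: "n \<notin> set u \<Longrightarrow> tail_length n (u @ n # d) = Suc (length d)"
  unfolding tail_length_def by (subst dropWhile_append2) auto

lemma length_comb_lists: "v \<in> comb_lists t n \<Longrightarrow> length v = n"
  unfolding comb_lists_def using distinct_card[of v] by auto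

lemma finite_comb_lists: "finite (comb_lists t n)"
  by (rule finite_subset[OF _ finite_lists_length_eq[of "{1..n}" n]])
    (use length_comb_lists in \<open>auto simp: comb_lists_def\<close>)

lemma comb_lists_0: "comb_lists t 0 = {[]}"
  unfolding comb_lists_def teeth_sorted_def by auto

lemma comb_lists_insert_iff:
  assumes "Suc n \<notin> set (u @ d)"
  shows "u @ Suc n # d \<in> comb_lists t (Suc n) \<longleftrightarrow>
    u @ d \<in> comb_lists t n \<and> sorted_wrt (\<ge>) d \<and> (n \<in> set d \<longrightarrow> n mod t = 0)"
proof -
  have set: "set (u @ Suc n # d) = {1..Suc n} \<longleftrightarrow> set (u @ d) = {1..n}"
    using assms insert_ident[of "Suc n" "set (u @ d)" "{1..n}"]
    by (simp add: atLeastAtMostSuc_conv)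
  have dist: "distinct (u @ Suc n # d) \<longleftrightarrow> distinct (u @ d)"
    using assms by auto
  show ?thesis
  proof (cases "set (u @ d) = {1..n}")
    case True
    then have lt: "\<forall>x \<in> set (u @ d). x < Suc n" by auto
    \<comment> \<open>Hence the only tooth condition on the new entry is the one with
      \<open>n\<close>.\<close>
    have "Suc (Suc n) \<notin> set (u @ d)" using True by simp
    then have "teeth_sorted t (u @ Suc n # d) \<longleftrightarrow>
        teeth_sorted t (u @ d) \<and> (n \<in> set d \<longrightarrow> n mod t = 0)"
      using assms by (auto simp: teeth_sorted_def sorted_wrt_append)
    then show ?thesis
      unfolding comb_lists_def mem_Collect_eq
      by (simp only: set dist True avoids_312_insert_max[OF lt]) blast
  next
    case False
    then show ?thesis
      unfolding comb_lists_def mem_Collect_eq by (simp only: set simp_thms)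
  qed
qed

lemma comb_list_split:
  assumes "v \<in> comb_lists t (Suc n)"
  obtains u d where "v = u @ Suc n # d" "Suc n \<notin> set (u @ d)"
    "u @ d \<in> comb_lists t n" "sorted_wrt (\<ge>) d" "n \<in> set d \<longrightarrow> n mod t = 0"
proof -
  have "Suc n \<in> set v" "distinct v" using assms by (auto simp: comb_lists_def)
  then obtain u d where "v = u @ Suc n # d" by (meson split_list)
  moreover from this have "Suc n \<notin> set (u @ d)" using \<open>distinct v\<close> by auto
  ultimately show thesis using that assms comb_lists_insert_iff by blast
qed

text \<open>Here \<open>r\<close> is the number of entries that would follow \<open>Suc n\<close>.
  Suffixes inside the tail are decreasing, longer ones are not, and the whole tail is the first
  suffix to contain \<open>n\<close>; it is excluded when \<open>n\<close> and \<open>n + 1\<close>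
  share a tooth.\<close>

lemma tail_insert_iff:
  assumes w: "w \<in> comb_lists t n" and r: "r \<le> n"
  shows "sorted_wrt (\<ge>) (drop (n - r) w) \<and> (n \<in> set (drop (n - r) w) \<longrightarrow> n mod t = 0) \<longleftrightarrow>
    r + (if n mod t = 0 then 0 else 1) \<le> tail_length n w"
proof (cases n)
  case 0
  then show ?thesis using w r by (auto simp: comb_lists_0)
next
  case (Suc n')
  from w obtain u d where wud: "w = u @ n # d" "n \<notin> set (u @ d)" and ud: "u @ d \<in> comb_lists t n'"
    and d: "sorted_wrt (\<ge>) d"
    unfolding Suc by (rule comb_list_split)
  have lt: "\<forall>x \<in> set (u @ d). x < n" using ud Suc by (auto simp: comb_lists_def)
  have n: "n = length u + Suc (length d)" using length_comb_lists[OF w] wud by simp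
  have tl: "tail_length n w = Suc (length d)" using wud tail_length_append by auto
  consider "r \<le> length d" | "r = Suc (length d)" | "r > Suc (length d)" by linarith
  then show ?thesis
  proof cases
    case 1
    then have "n - r = Suc (length u + (length d - r))" using n by simp
    then have "drop (n - r) w = drop (length d - r) d" using wud by simp
    moreover have "n \<notin> set (drop (length d - r) d)" using wud by (auto dest: in_set_dropD)
    ultimately show ?thesis using 1 tl d by (auto intro: sorted_wrt_drop)
  next
    case 2
    then have "drop (n - r) w = n # d" using n wud by simp
    then show ?thesis using 2 tl d lt by (auto intro: less_imp_le)
  next
    case 3
    define i where "i = n - r"
    have i: "i < length u" using 3 n r unfolding i_def by linarith
    have "drop i w = drop i u @ n # d" using i wud by simp
    moreover have "drop i u \<noteq> []" using i by simp
    \<comment> \<open>An entry before the maximum \<open>n\<close> forms an ascent with it.\<close>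
    then obtain x where "x \<in> set (drop i u)" by (meson ex_in_conv set_empty)
    moreover from this have "x < n" using lt by (auto dest: in_set_dropD)
    ultimately have "\<not> sorted_wrt (\<ge>) (drop i w)"
      by (metis leD list.set_intros(1) sorted_wrt_append)
    then show ?thesis using 3 tl unfolding i_def by simp
  qed
qed

lemma tail_length_le: "v \<in> comb_lists t n \<Longrightarrow> tail_length n v \<le> n"
  using length_comb_lists[of v t n] length_dropWhile_le[of "\<lambda>x. x \<noteq> n" v]
  by (simp add: tail_length_def)

text \<open>Inserting \<open>Suc n\<close> in front of the last \<open>r\<close> entries is a
  bijection, inverted by deleting it; the new tail also counts \<open>Suc n\<close> itself, whence
  \<open>Suc r\<close>.\<close>

lemma card_tail_length_eq:
  "card {v \<in> comb_lists t (Suc n). tail_length (Suc n) v = Suc r} =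
   card {w \<in> comb_lists t n. r + (if n mod t = 0 then 0 else 1) \<le> tail_length n w}"
  (is "card ?A = card ?B")
proof -
  define f where "f w = take (n - r) w @ Suc n # drop (n - r) w" for w
  have fresh: "Suc n \<notin> set w" if "w \<in> ?B" for w
    using that by (auto simp: comb_lists_def)
  have inj: "inj_on f ?B"
  proof (rule inj_on_inverseI)
    fix w assume "w \<in> ?B"
    then have "Suc n \<notin> set w" by (rule fresh)
    then have "Suc n \<notin> set (take (n - r) w)" "Suc n \<notin> set (drop (n - r) w)"
      by (auto dest: in_set_takeD in_set_dropD)
    then show "removeAll (Suc n) (f w) = w" by (simp add: f_def)
  qed
  have "f ` ?B = ?A"
  proof (intro equalityI subsetI)
    fix v assume "v \<in> f ` ?B"
    then obtain w where w: "w \<in> ?B" "v = f w" by blast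
    have r: "r \<le> n" using w tail_length_le[of w t n] by auto
    have fr: "Suc n \<notin> set (take (n - r) w @ drop (n - r) w)" using fresh[OF w(1)] by simp
    have "v \<in> comb_lists t (Suc n)"
      unfolding w(2) f_def comb_lists_insert_iff[OF fr]
      using w tail_insert_iff[of w t n r] r by auto
    moreover have "tail_length (Suc n) v = Suc r"
      unfolding w(2) f_def using fr w r length_comb_lists[of w t n]
      by (subst tail_length_append) (auto dest: in_set_takeD)
    ultimately show "v \<in> ?A" by simp
  next
    fix v assume v: "v \<in> ?A"
    then obtain u d where ud: "v = u @ Suc n # d" "Suc n \<notin> set (u @ d)"
      "u @ d \<in> comb_lists t n" "sorted_wrt (\<ge>) d" "n \<in> set d \<longrightarrow> n mod t = 0"
      using comb_list_split[of v t n] by blast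
    have "r = length d" using v ud tail_length_append[of "Suc n" u d] by auto
    moreover have "n = length u + length d" using length_comb_lists[OF ud(3)] by simp
    ultimately have "n - r = length u" "r \<le> n" by auto
    then have "u @ d \<in> ?B" "v = f (u @ d)"
      using tail_insert_iff[OF ud(3), of r] ud by (auto simp: f_def)
    then show "v \<in> f ` ?B" by blast
  qed
  then show ?thesis using card_image[OF inj] by simp
qed

text \<open>Counting tails of length at least \<open>j\<close> instead of exactly \<open>j\<close>
  makes the recurrence two-term, like that of \<open>forest_number\<close>.\<close>

definition tail_count :: "nat \<Rightarrow> nat \<Rightarrow> nat \<Rightarrow> nat" where
  "tail_count t n j = card {v \<in> comb_lists t n. j \<le> tail_length n v}"

lemma tail_count_rec:
  "tail_count t (Suc n) (Suc r) = tail_count t (Suc n) (Suc (Suc r)) +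
     tail_count t n (r + (if n mod t = 0 then 0 else 1))"
proof -
  have "{v \<in> comb_lists t (Suc n). Suc r \<le> tail_length (Suc n) v} =
     {v \<in> comb_lists t (Suc n). Suc (Suc r) \<le> tail_length (Suc n) v} \<union>
     {v \<in> comb_lists t (Suc n). tail_length (Suc n) v = Suc r}"
    by auto
  then have "tail_count t (Suc n) (Suc r) = tail_count t (Suc n) (Suc (Suc r)) +
    card {v \<in> comb_lists t (Suc n). tail_length (Suc n) v = Suc r}"
    unfolding tail_count_def using finite_comb_lists
    by (simp only:) (subst card_Un_disjoint, auto)
  then show ?thesis unfolding card_tail_length_eq by (simp add: tail_count_def)
qed

lemma tail_count_0: "tail_count t (Suc n) 0 = tail_count t (Suc n) (Suc 0)"
proof -
  have "tail_length (Suc n) v \<ge> 1" if "v \<in> comb_lists t (Suc n)" for v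
    using that by (elim comb_list_split) (auto simp: tail_length_append)
  then show ?thesis
    unfolding tail_count_def by (intro arg_cong[where f = card]) auto
qed

text \<open>The longest possible tail has \<open>(n + t - 1) div t\<close> entries, one from each tooth that has been
  started.\<close>

lemma tail_count_eq_forest_number:
  assumes t: "t > 0"
  shows "(\<forall>j > (n + t - 1) div t. tail_count t n j = 0) \<and>
    (\<forall>s \<le> n div t. tail_count t n ((n + t - 1) div t - s) = forest_number (t + 1) (n + 1 - t * s) s)"
proof (induction n)
  case 0
  then show ?case using t by (simp add: tail_count_def comb_lists_0 tail_length_def)
next
  case (Suc n)
  \<comment> \<open>\<open>c\<close> and \<open>c'\<close> are \<open>n / t\<close> and
    \<open>(n + 1) / t\<close> rounded up. The parameter \<open>s\<close> measures how far the tail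
    bound lies below this maximum.\<close>
  define c where "c = (n + t - 1) div t"
  define c' where "c' = (Suc n + t - 1) div t"
  have c': "c' = Suc (n div t)" using t by (simp add: c'_def)
  have c: "c = n div t + (if n mod t = 0 then 0 else 1)"
  proof -
    have "n + t - 1 = (n mod t + t - 1) + n div t * t"
      using t div_mult_mod_eq[of n t] by linarith
    then have "c = n div t + (n mod t + t - 1) div t"
      using t unfolding c_def by (simp only: div_mult_self1)
    moreover have "(r + t - 1) div t = 1" if "r \<noteq> 0" "r < t" for r
      using that by (intro div_nat_eqI) auto
    ultimately show ?thesis using t mod_less_divisor[OF t, of n] by auto
  qed
  have IH1: "tail_count t n j = 0" if "j > c" for j
    using Suc.IH that c_def by blast
  have IH2: "tail_count t n (c - s) = forest_number (t + 1) (n + 1 - t * s) s" if "s \<le> n div t" for s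
    using Suc.IH that c_def by blast
  have zero: "tail_count t (Suc n) j = 0" if j: "j > c'" for j
  proof -
    \<comment> \<open>Descent from a bound exceeding the length of the list: each step down adds a
      count at level \<open>n\<close> that vanishes by \<open>IH1\<close>.\<close>
    have "tail_count t (Suc n) (j + i) = 0 \<Longrightarrow> tail_count t (Suc n) j = 0" for i
    proof (induction i)
      case (Suc i)
      obtain r where r: "j + i = Suc r" using j by (cases "j + i") auto
      have "r + (if n mod t = 0 then 0 else 1) > c" using r j c c' by auto
      then show ?case
        using Suc tail_count_rec[of t n r] IH1 r by simp
    qed simp
    moreover have "tail_count t (Suc n) (j + Suc n) = 0"
    proof -
      have "{v \<in> comb_lists t (Suc n). j + Suc n \<le> tail_length (Suc n) v} = {}"
        using tail_length_le[of _ t "Suc n"] j by fastforce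
      then show ?thesis unfolding tail_count_def by (metis card.empty)
    qed
    ultimately show ?thesis by blast
  qed
  have step: "tail_count t (Suc n) (c' - s) =
      tail_count t (Suc n) (Suc (c' - s)) + forest_number (t + 1) (n + 1 - t * s) s"
    \<comment> \<open>Measured from the maximum, the recurrence relates equal values of
      \<open>s\<close> at levels \<open>n\<close> and \<open>Suc n\<close>, whether or not
      \<open>n\<close> completes a tooth.\<close>
    if "s \<le> n div t" for s
  proof -
    have "c' - s = Suc (n div t - s)" using that c' by simp
    moreover have "n div t - s + (if n mod t = 0 then 0 else 1) = c - s" using that c by simp
    ultimately show ?thesis
      using tail_count_rec[of t n "n div t - s"] IH2[OF that] by simp
  qed
  have "tail_count t (Suc n) (c' - s) = forest_number (t + 1) (Suc n + 1 - t * s) s"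
    if "s \<le> Suc n div t" for s
    using that
  proof (induction s)
    case 0
    then show ?case using step[of 0] zero[of "Suc c'"] by simp
  next
    case (Suc s)
    have ts: "t * Suc s \<le> Suc n"
      using Suc.prems t by (simp add: less_eq_div_iff_mult_less_eq mult.commute)
    have IH: "tail_count t (Suc n) (c' - s) = forest_number (t + 1) (Suc n + 1 - t * s) s"
      using Suc by simp
    have le: "s \<le> n div t"
      using ts t by (simp add: less_eq_div_iff_mult_less_eq mult.commute)
    have rec: "forest_number (t + 1) (Suc n + 1 - t * Suc s) (Suc s) =
      forest_number (t + 1) (n + 1 - t * Suc s) (Suc s) + forest_number (t + 1) (Suc n + 1 - t * s) s"
    proof -
      have "Suc n + 1 - t * Suc s = Suc (n + 1 - t * Suc s)"
        "n + 1 - t * Suc s + (t + 1) = Suc n + 1 - t * s" using ts by auto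
      then show ?thesis by (simp only: forest_number.simps)
    qed
    show ?case
    proof (cases "Suc s \<le> n div t")
      case True
      then have "Suc (c' - Suc s) = c' - s" using c' by simp
      then show ?thesis using step[OF True] IH rec by simp
    next
      \<comment> \<open>Now \<open>n + 1 = t * Suc s\<close>: a tooth has just been completed. The
        bound drops from 1 to 0, which changes nothing since tails are nonempty, and the matching
        term counts forests of no trees with \<open>Suc s\<close> nodes, so it is 0.\<close>
      case False
      then have "s = n div t" using le by simp
      then have "c' - s = Suc 0" "c' - Suc s = 0" using c' by auto
      moreover have "n + 1 - t * Suc s = 0"
        using False t by (simp add: less_eq_div_iff_mult_less_eq mult.commute)
      ultimately show ?thesis using IH rec tail_count_0 by simp
    qed
  qed
  then show ?case using zero unfolding c'_def by blast
qed

text \<open>At \<open>n = s * t\<close> the longest tail has length \<open>s\<close>. Going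
  \<open>s\<close> below it removes the condition on the tail and leaves
  \<open>n + 1 - t * s = 1\<close> tree.\<close>

lemma card_comb_lists:
  assumes "t > 0"
  shows "card (comb_lists t (s * t)) = forest_number (t + 1) 1 s"
proof -
  have "(s * t + t - 1) div t = s" "s * t div t = s"
    using assms by (auto intro!: div_nat_eqI simp: mult.commute[of s])
  then show ?thesis
    using tail_count_eq_forest_number[OF assms, of "s * t"] by (auto simp: tail_count_def mult.commute)
qed

section \<open>Linear extensions of the comb\<close>

text \<open>Linear extensions need only respect the generators of the order, and avoidance takes
  care of those on the spine.\<close>

lemma linear_extension_comb_iff:
  assumes t: "t > 1" and av: "avoids_312 v"
  shows "linear_extension (comb_carrier s t) (comb_order s t) v \<longleftrightarrow>
    distinct v \<and> set v = {1..s * t} \<and> teeth_sorted t v"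
proof
  assume L: "linear_extension (comb_carrier s t) (comb_order s t) v"
  have set: "set v = {1..s * t}" and dist: "distinct v"
    using L by (auto simp: linear_extension_def comb_carrier_def)
  have "b mod t = 0" if "i < j" "j < length v" "v ! i = Suc b" "v ! j = b" for i j b
  proof (rule ccontr)
    assume nz: "b mod t \<noteq> 0"
    have "v ! i \<in> set v" "v ! j \<in> set v" using that nth_mem[of i v] nth_mem[of j v] by auto
    then have b: "1 \<le> b" "Suc b \<le> s * t" using that set by auto
    then have "b div t < s" using t by (auto simp: less_mult_imp_div_less)
    moreover have "b = b div t * t + b mod t" "b mod t < t" using t by auto
    ultimately have "(b, Suc b) \<in> comb_generators s t"
      unfolding comb_generators_def using nz
      \<comment> \<open>The entry \<open>b\<close> is number \<open>b mod t\<close> on tooth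
        \<open>b div t\<close>.\<close>
      by (intro UnI2 CollectI exI[of _ "b div t"] exI[of _ "b mod t"]) simp
    then have "(b, Suc b) \<in> comb_order s t"
      using b unfolding comb_order_def comb_carrier_def by auto
    then have "j < i" using L that unfolding linear_extension_def by auto
    then show False using that by simp
  qed
  then have "teeth_sorted t v"
    unfolding teeth_sorted_def sorted_wrt_iff_nth_less by simp
  then show "distinct v \<and> set v = {1..s * t} \<and> teeth_sorted t v" using set dist by blast
next
  assume "distinct v \<and> set v = {1..s * t} \<and> teeth_sorted t v"
  then have dist: "distinct v" and set: "set v = {1..s * t}" and teeth: "teeth_sorted t v" by auto
  \<comment> \<open>Order of appearance in \<open>v\<close>; as the entries are distinct, it is
    total on the carrier and transitive, so it extends from generators to their closure.\<close>
  define before where "before x y \<longleftrightarrow> (\<exists>i j. i < j \<and> j < length v \<and> v ! i = x \<and> v ! j = y)" for x y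
  have total: "before x y \<or> before y x" if xy: "x \<in> {1..s * t}" "y \<in> {1..s * t}" "x \<noteq> y" for x y
  proof -
    obtain i j where "i < length v" "j < length v" "v ! i = x" "v ! j = y"
      using xy(1,2) unfolding set[symmetric] in_set_conv_nth by blast
    then show ?thesis
      using xy(3) unfolding before_def by (cases i j rule: linorder_cases) auto
  qed
  have trans: "before x z" if xyz: "before x y" "before y z" for x y z
  proof -
    obtain i j j' k where "i < j" "j < length v" "v ! i = x" "v ! j = y"
      "j' < k" "k < length v" "v ! j' = y" "v ! k = z"
      using xyz unfolding before_def by blast
    moreover from this have "j = j'" using nth_eq_iff_index_eq[OF dist, of j j'] by simp
    ultimately show ?thesis unfolding before_def by (intro exI[where x = i] exI[where x = k]) auto
  qed
  have tooth: "before b (Suc b)" if "1 \<le> b" "Suc b \<le> s * t" "b mod t \<noteq> 0" for b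
  proof -
    have "\<not> before (Suc b) b"
      using teeth that(3) unfolding teeth_sorted_def sorted_wrt_iff_nth_less before_def by blast
    then show ?thesis using total[of b "Suc b"] that by auto
  qed
  have spine: "before (c * t + 1) ((c + 1) * t + 1)" if "c + 2 \<le> s" for c
  proof (rule ccontr)
    have le: "(c + 2) * t \<le> s * t" using that by (rule mult_le_mono1)
    assume "\<not> ?thesis"
    then have "before ((c + 1) * t + 1) (c * t + 1)"
      using total[of "c * t + 1" "(c + 1) * t + 1"] le t by auto
    \<comment> \<open>As \<open>t > 1\<close>, the entry \<open>c * t + 2\<close> is on the same
      tooth and below \<open>(c + 1) * t + 1\<close>, so it can serve as the 2 of a 312.\<close>
    moreover have "before (c * t + 1) (Suc (c * t + 1))"
      using le t by (intro tooth) (auto simp: mod_Suc)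
    ultimately obtain i j j' k where ij: "i < j" "j < length v" "v ! i = (c + 1) * t + 1" "v ! j = c * t + 1"
      and jk: "j' < k" "k < length v" "v ! j' = c * t + 1" "v ! k = Suc (c * t + 1)"
      unfolding before_def by blast
    have "j = j'" using nth_eq_iff_index_eq[OF dist, of j j'] ij jk by simp
    then have "\<not> (v ! j < v ! k \<and> v ! k < v ! i)"
      using av ij(1) jk(1,2) unfolding avoids_312_iff_nth by blast
    then show False using t unfolding ij jk by simp
  qed
  have gen: "before x y" if "(x, y) \<in> comb_generators s t" for x y
    using that unfolding comb_generators_def
  proof (elim UnE CollectE exE conjE)
    fix c j assume j: "(x, y) = (c * t + j, c * t + j + 1)" "c < s" "1 \<le> j" "j < t"
    have "Suc c * t \<le> s * t" using j(2) by (intro mult_le_mono1) simp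
    then show "before x y" using j tooth[of "c * t + j"] by auto
  qed (use spine in auto)
  have "x = y \<or> before x y" if "(x, y) \<in> (comb_generators s t)\<^sup>*" for x y
    using that
  proof (induction rule: rtrancl_induct)
    case (step y z)
    then show ?case using gen[of y z] trans[of x y z] by auto
  qed simp
  then have ord: "before x y" if "(x, y) \<in> comb_order s t" "x \<noteq> y" for x y
    using that unfolding comb_order_def by blast
  have "i < j" if ij: "i < length v" "j < length v" "(v ! i, v ! j) \<in> comb_order s t" "v ! i \<noteq> v ! j" for i j
  proof -
    obtain i' j' where ij': "i' < j'" "j' < length v" "v ! i' = v ! i" "v ! j' = v ! j"
      using ord[OF ij(3,4)] unfolding before_def by blast
    have "i' < length v" using ij' by simp
    then have "i' = i" "j' = j"
      using nth_eq_iff_index_eq[OF dist, of i' i] nth_eq_iff_index_eq[OF dist, of j' j] ij(1,2) ij'(2-4)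
      by simp_all
    then show ?thesis using ij'(1) by simp
  qed
  then show "linear_extension (comb_carrier s t) (comb_order s t) v"
    using dist set unfolding linear_extension_def comb_carrier_def by simp
qed

theorem theorem2:
  fixes s t :: nat
  assumes "s \<ge> 1" and "t > 1"
  shows "real (card {v. linear_extension (comb_carrier s t) (comb_order s t) v \<and> avoids3 v [3, 1, 2]})
           = 1 / (real t * real s + 1) * real ((s * (t + 1)) choose s)
       \<and> real (card {T. kary_tree (t + 1) T \<and> num_nodes T = s})
           = 1 / (real t * real s + 1) * real ((s * (t + 1)) choose s)"
proof -
  have "{v. linear_extension (comb_carrier s t) (comb_order s t) v \<and> avoids3 v [3, 1, 2]} =
      comb_lists t (s * t)"
    using linear_extension_comb_iff[OF assms(2)]
    unfolding comb_lists_def avoids3_312_iff by blast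
  then show ?thesis
    using assms card_comb_lists[of t s] card_kary_trees[of "t + 1" s] forest_number_single[of t s]
    by simp
qed

end
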